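(* There exist a simply connected Riemann surface $\Omega$, a complete proper conformal minimal immersion $X:\Omega\to\mathbb{R}^3$, and constants $C,c>0$ such that $$\int_{X^{-1}(B_R)}dA_X\ \ge\ C e^{cR}$$ for all sufficiently large $R$.
   Context: $B_R$ is the Euclidean ball of radius $R$ centered at the origin in $\mathbb{R}^3$. A conformal minimal immersion $X:\Omega\to\mathbb{R}^3$ of a Riemann surface is an immersion that is conformal and whose coordinate functions are harmonic. $dA_X$ is the area element on $\Omega$ of the metric induced by $X$, so area is parametrized area, counted with multiplicity. $X$ is proper if the preimage of every compact subset of $\mathbb{R}^3$ is compact, and complete if the induced metric on $\Omega$ is complete. *)

theory Defs
  imports "HOL-Analysis.Analysis"
begin

section \<open>Riemann surfaces\<close>

text \<open>A chart is a pair of its domain and the coordinate map. The atlas need not be maximal: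
  any atlas of holomorphically compatible charts determines the complex structure.\<close>

type_synonym 'a chart = "'a set \<times> ('a \<Rightarrow> complex)"

definition complex_chart :: "'a topology \<Rightarrow> 'a chart \<Rightarrow> bool" where
  "complex_chart T = (\<lambda>(U, \<phi>). openin T U \<and> open (\<phi> ` U) \<and>
     homeomorphic_map (subtopology T U) (top_of_set (\<phi> ` U)) \<phi>)"

definition holomorphic_atlas :: "'a topology \<Rightarrow> 'a chart set \<Rightarrow> bool" where
  "holomorphic_atlas T A \<longleftrightarrow>
     (\<forall>k\<in>A. complex_chart T k) \<and> (\<Union>(U, \<phi>)\<in>A. U) = topspace T \<and>
     (\<forall>(U, \<phi>)\<in>A. \<forall>(V, \<psi>)\<in>A. (\<psi> \<circ> inv_into U \<phi>) holomorphic_on \<phi> ` (U \<inter> V))"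

text \<open>A second countable Hausdorff surface has at most continuum many points, so up to
  isomorphism every Riemann surface has its points in the type \<^typ>\<open>complex\<close>, with a
  topology and atlas that need not be related to those of the complex plane.\<close>

definition riemann_surface :: "'a topology \<Rightarrow> 'a chart set \<Rightarrow> bool" where
  "riemann_surface T A \<longleftrightarrow> topspace T \<noteq> {} \<and> connected_space T \<and> Hausdorff_space T \<and>
     second_countable T \<and> holomorphic_atlas T A"

text \<open>The definition of \<^const>\<open>simply_connected\<close>, for an abstract topology.
  Path connectedness is the case of two constant loops.\<close>

definition simply_connected_space :: "'a topology \<Rightarrow> bool" where
  "simply_connected_space T \<longleftrightarrow>
     (\<forall>p q. pathin T p \<and> p 1 = p 0 \<and> pathin T q \<and> q 1 = q 0 \<longrightarrow>
        homotopic_with (\<lambda>r. r 1 = r 0) (top_of_set {0..1}) T p q)"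


section \<open>Conformal minimal immersions\<close>

definition partial_deriv ::
    "complex \<Rightarrow> (complex \<Rightarrow> 'b::real_normed_vector) \<Rightarrow> complex \<Rightarrow> 'b" where
  "partial_deriv v f z = frechet_derivative f (at z) v"

definition C2_on :: "(complex \<Rightarrow> real) \<Rightarrow> complex set \<Rightarrow> bool" where
  "C2_on u S \<longleftrightarrow> u differentiable_on S \<and>
     (\<forall>v\<in>{1, \<i>}. partial_deriv v u differentiable_on S \<and>
        (\<forall>w\<in>{1, \<i>}. continuous_on S (partial_deriv w (partial_deriv v u))))"

definition harmonic_on :: "(complex \<Rightarrow> real) \<Rightarrow> complex set \<Rightarrow> bool" where
  "harmonic_on u S \<longleftrightarrow> C2_on u S \<and>
     (\<forall>z\<in>S. partial_deriv 1 (partial_deriv 1 u) z + partial_deriv \<i> (partial_deriv \<i> u) z = 0)"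

definition in_chart :: "('a \<Rightarrow> 'b) \<Rightarrow> 'a chart \<Rightarrow> complex \<Rightarrow> 'b" where
  "in_chart X = (\<lambda>(U, \<phi>). X \<circ> inv_into U \<phi>)"

definition conformal_minimal_immersion :: "'a chart set \<Rightarrow> ('a \<Rightarrow> real^3) \<Rightarrow> bool" where
  "conformal_minimal_immersion A X \<longleftrightarrow>
     (\<forall>(U, \<phi>)\<in>A. let f = in_chart X (U, \<phi>) in
        (\<forall>i. harmonic_on (\<lambda>z. f z $ i) (\<phi> ` U)) \<and>
        (\<forall>z\<in>\<phi> ` U. inj (frechet_derivative f (at z)) \<and>
           (\<exists>\<rho>>0. \<forall>v w. frechet_derivative f (at z) v \<bullet> frechet_derivative f (at z) w
                         = \<rho> * (v \<bullet> w))))"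

definition proper_immersion :: "'a topology \<Rightarrow> ('a \<Rightarrow> real^3) \<Rightarrow> bool" where
  "proper_immersion T X \<longleftrightarrow> (\<forall>K. compact K \<longrightarrow> compactin T {p \<in> topspace T. X p \<in> K})"


section \<open>Completeness of the induced metric\<close>

definition piecewise_C1_path :: "'a topology \<Rightarrow> 'a chart set \<Rightarrow> (real \<Rightarrow> 'a) \<Rightarrow> bool" where
  "piecewise_C1_path T A \<gamma> \<longleftrightarrow> pathin T \<gamma> \<and>
     (\<forall>(U, \<phi>)\<in>A. \<forall>a b. 0 \<le> a \<and> a \<le> b \<and> b \<le> 1 \<and> \<gamma> ` {a..b} \<subseteq> U \<longrightarrow>
        (\<phi> \<circ> \<gamma>) piecewise_C1_differentiable_on {a..b})"

text \<open>The length of a path in the metric induced by \<open>X\<close> is the Euclidean length of its image.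
  The derivative of a function in the sense of \<^const>\<open>piecewise_C1_differentiable_on\<close> may blow up
  at the exceptional points; stating the length by \<^const>\<open>has_integral\<close>
  leaves out the paths of infinite length.\<close>

definition induced_lengths ::
    "'a topology \<Rightarrow> 'a chart set \<Rightarrow> ('a \<Rightarrow> real^3) \<Rightarrow> 'a \<Rightarrow> 'a \<Rightarrow> real set" where
  "induced_lengths T A X p q =
     {L. \<exists>\<gamma>. piecewise_C1_path T A \<gamma> \<and> \<gamma> 0 = p \<and> \<gamma> 1 = q \<and>
          ((\<lambda>t. norm (vector_derivative (X \<circ> \<gamma>) (at t))) has_integral L) {0..1}}"

text \<open>The value 0 off the surface is needed because \<^const>\<open>Metric_space\<close> asks for symmetry and
  nonnegativity on the whole type.\<close>

definition induced_dist ::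
    "'a topology \<Rightarrow> 'a chart set \<Rightarrow> ('a \<Rightarrow> real^3) \<Rightarrow> 'a \<Rightarrow> 'a \<Rightarrow> real" where
  "induced_dist T A X p q =
     (if p \<in> topspace T \<and> q \<in> topspace T then Inf (induced_lengths T A X p q) else 0)"

text \<open>The conjunct \<^const>\<open>Metric_space\<close> holds for every immersion of a Riemann surface; it is
  there because \<^const>\<open>Metric_space.mcomplete\<close> has its meaning only under it.\<close>

definition complete_immersion ::
    "'a topology \<Rightarrow> 'a chart set \<Rightarrow> ('a \<Rightarrow> real^3) \<Rightarrow> bool" where
  "complete_immersion T A X \<longleftrightarrow>
     Metric_space (topspace T) (induced_dist T A X) \<and>
     Metric_space.mcomplete (topspace T) (induced_dist T A X)"


section \<open>Area\<close>

text \<open>The square root of the determinant of the first fundamental form.\<close>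

definition area_density :: "(complex \<Rightarrow> real^3) \<Rightarrow> complex \<Rightarrow> real" where
  "area_density f z =
     (let fx = partial_deriv 1 f z; fy = partial_deriv \<i> f z
      in sqrt ((fx \<bullet> fx) * (fy \<bullet> fy) - (fx \<bullet> fy)\<^sup>2))"

text \<open>The area element as a Borel measure on the surface, determined by its values inside charts:
  the surface is a countable union of chart domains.\<close>

definition area_element ::
    "'a topology \<Rightarrow> 'a chart set \<Rightarrow> ('a \<Rightarrow> real^3) \<Rightarrow> 'a measure \<Rightarrow> bool" where
  "area_element T A X dA \<longleftrightarrow>
     sets dA = sigma_sets (topspace T) {W. openin T W} \<and>
     (\<forall>(U, \<phi>)\<in>A. \<forall>E\<in>sets dA. E \<subseteq> U \<longrightarrow>
        emeasure dA E =
          (\<integral>\<^sup>+ z\<in>\<phi> ` E. ennreal (area_density (in_chart X (U, \<phi>)) z) \<partial>lborel))"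

end

theory Submission
  imports Defs "HOL-Complex_Analysis.Cauchy_Integral_Formula"
begin

text \<open>The surface is the plane, with height \<open>X\<^sub>3 = Re z\<close> and with Gauss map
  \<open>g = exp (z + \<epsilon>)\<close>, where \<open>\<epsilon> = exp (-z) (1 - exp (-z)) / z\<close>. Then \<open>X\<^sub>1 + \<i> X\<^sub>2\<close> is half the conjugate of
  \<open>H = \<integral> 1 / g\<close> minus half of \<open>K = \<integral> g\<close>. On a strip \<open>\<bar>Re z\<bar> \<le> M\<close> the integrand \<open>g\<close> is
  \<open>exp z + 1 / z - exp (-z) / z\<close> up to an integrable error, so \<open>K = ln \<bar>Im z\<bar> + O(1)\<close>,
  while \<open>H = O(1)\<close>. Hence \<open>X\<close> tends to infinity on every strip, and since the height
  takes care of the complement of the strips, \<open>X\<close> is proper. On the other hand \<open>X\<close> maps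
  \<open>\<bar>Re z\<bar> \<le> 1, 1 \<le> Im z \<le> exp R\<close> into the ball of radius \<open>R\<close> for large \<open>R\<close>, and the area of this
  rectangle is at least its Euclidean area because the conformal factor
  \<open>(\<bar>g\<bar> + 1 / \<bar>g\<bar>)\<^sup>2 / 4\<close> is at least 1. The same bound yields completeness.\<close>

section \<open>Conformal metrics on the plane\<close>

lemma valid_path_vector_derivative:
  assumes "valid_path g"
  obtains S where "finite S"
    "\<And>t. t \<in> {0..1} - S \<Longrightarrow> (g has_vector_derivative vector_derivative g (at t)) (at t)"
  using assms
  by (auto simp: valid_path_def piecewise_C1_differentiable_on_def C1_differentiable_on_eq
      vector_derivative_works)

text \<open>Substitution of \<open>1 - t\<close> for \<open>t\<close>; the derivative only changes
  sign off the reflected exceptional set. This makes the induced distance symmetric.\<close>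

lemma weighted_length_reversepath:
  assumes g: "valid_path g"
    and L: "((\<lambda>t. l (g t) * norm (vector_derivative g (at t))) has_integral L) {0..1}"
  shows "((\<lambda>t. l (reversepath g t) * norm (vector_derivative (reversepath g) (at t)))
           has_integral L) {0..1}"
proof -
  obtain S where S: "finite S"
    "\<And>t. t \<in> {0..1} - S \<Longrightarrow> (g has_vector_derivative vector_derivative g (at t)) (at t)"
    using valid_path_vector_derivative[OF g] by metis
  have *: "vector_derivative (reversepath g) (at t) = - vector_derivative g (at (1 - t))"
    if t: "t \<in> {0..1} - (\<lambda>x. 1 - x) ` S" for t
  proof -
    have "1 - t \<notin> S"
      using t by (metis DiffD2 diff_diff_eq2 add_diff_cancel_left' imageI)
    then have "(g has_vector_derivative vector_derivative g (at (1 - t))) (at (1 - t))"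
      using S(2) t by auto
    then have "(g \<circ> (\<lambda>x. 1 - x) has_vector_derivative -1 *\<^sub>R vector_derivative g (at (1 - t))) (at t)"
      by (intro vector_diff_chain_at derivative_eq_intros | simp)+
    then show ?thesis
      by (intro vector_derivative_at) (simp add: reversepath_def o_def)
  qed
  have "((\<lambda>t. l (g (1 - t)) * norm (vector_derivative g (at (1 - t)))) has_integral L) {0..1}"
    using has_integral_affinity01 [where m= "-1" and c=1, OF L] by simp
  then show ?thesis
    using S(1) *
    by (elim has_integral_spike_finite[rotated 2, where S = "(\<lambda>x. 1 - x) ` S"])
       (auto simp: reversepath_def)
qed

text \<open>Additivity of length under concatenation, from which the triangle inequality for the
  induced distance follows.\<close>

lemma weighted_length_join:
  assumes g1: "valid_path g1" and g2: "valid_path g2"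
    and L1: "((\<lambda>t. l (g1 t) * norm (vector_derivative g1 (at t))) has_integral L1) {0..1}"
    and L2: "((\<lambda>t. l (g2 t) * norm (vector_derivative g2 (at t))) has_integral L2) {0..1}"
  shows "((\<lambda>t. l ((g1 +++ g2) t) * norm (vector_derivative (g1 +++ g2) (at t)))
           has_integral (L1 + L2)) {0..1}" (is "(?f has_integral _) _")
proof -
  obtain S1 where S1: "finite S1"
    "\<And>t. t \<in> {0..1} - S1 \<Longrightarrow> (g1 has_vector_derivative vector_derivative g1 (at t)) (at t)"
    using valid_path_vector_derivative[OF g1] by metis
  obtain S2 where S2: "finite S2"
    "\<And>t. t \<in> {0..1} - S2 \<Longrightarrow> (g2 has_vector_derivative vector_derivative g2 (at t)) (at t)"
    using valid_path_vector_derivative[OF g2] by metis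
  \<comment> \<open>Each half is run through at double speed on an interval of half the length, so
    the factor 2 keeps the integrals unchanged.\<close>
  have i1: "((\<lambda>t. 2 * (l (g1 (2*t)) * norm (vector_derivative g1 (at (2*t))))) has_integral L1) {0..1/2}"
   and i2: "((\<lambda>t. 2 * (l (g2 (2*t-1)) * norm (vector_derivative g2 (at (2*t-1))))) has_integral L2) {1/2..1}"
    using has_integral_affinity01 [OF L1, where m= 2 and c=0, THEN has_integral_cmul [where c=2]]
          has_integral_affinity01 [OF L2, where m= 2 and c="-1", THEN has_integral_cmul [where c=2]]
    by (simp_all only: image_affinity_atLeastAtMost_div_diff, simp_all)
  have d1: "vector_derivative (g1 +++ g2) (at t) = 2 *\<^sub>R vector_derivative g1 (at (2*t))"
    if t: "0 \<le> t" "t < 1/2" "2*t \<notin> S1" for t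
  proof (rule vector_derivative_at, rule has_vector_derivative_transform_within)
    have "(g1 \<circ> (\<lambda>x. 2*x) has_vector_derivative 2 *\<^sub>R vector_derivative g1 (at (2*t))) (at t)"
      using S1(2)[of "2*t"] t
      by (intro vector_diff_chain_at derivative_eq_intros | simp)+
    then show "((\<lambda>x. g1 (2*x)) has_vector_derivative 2 *\<^sub>R vector_derivative g1 (at (2*t))) (at t)"
      by (simp add: o_def)
    show "0 < 1/2 - t" using t by simp
  qed (use t in \<open>auto simp: joinpaths_def dist_real_def\<close>)
  have d2: "vector_derivative (g1 +++ g2) (at t) = 2 *\<^sub>R vector_derivative g2 (at (2*t-1))"
    if t: "1/2 < t" "t \<le> 1" "2*t-1 \<notin> S2" for t
  proof (rule vector_derivative_at, rule has_vector_derivative_transform_within)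
    have "(g2 \<circ> (\<lambda>x. 2*x-1) has_vector_derivative 2 *\<^sub>R vector_derivative g2 (at (2*t-1))) (at t)"
      using S2(2)[of "2*t-1"] t
      by (intro vector_diff_chain_at derivative_eq_intros | simp)+
    then show "((\<lambda>x. g2 (2*x-1)) has_vector_derivative 2 *\<^sub>R vector_derivative g2 (at (2*t-1))) (at t)"
      by (simp add: o_def)
    show "0 < t - 1/2" using t by simp
  qed (use t in \<open>auto simp: joinpaths_def dist_real_def\<close>)
  have "(?f has_integral L1) {0..1/2}"
  proof (rule has_integral_spike_finite[OF _ _ i1])
    \<comment> \<open>The joined path may have a corner at \<open>1/2\<close>, so this point is
      added to the exceptional parameters.\<close>
    show "finite (insert (1/2) ((*) 2 -` S1))"
      using S1 by (force intro: finite_vimageI [where h = "(*)2"] inj_onI)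
    fix t assume "t \<in> {0..1/2} - insert (1/2) ((*) 2 -` S1)"
    then have "0 \<le> t" "t < 1/2" "2*t \<notin> S1" by auto
    then show "?f t = 2 * (l (g1 (2*t)) * norm (vector_derivative g1 (at (2*t))))"
      using d1[of t] by (simp, simp add: joinpaths_def)
  qed
  moreover have "(?f has_integral L2) {1/2..1}"
  proof (rule has_integral_spike_finite[OF _ _ i2])
    show "finite (insert (1/2) ((\<lambda>x. 2*x-1) -` S2))"
      using S2 by (force intro: finite_vimageI [where h = "\<lambda>x. 2*x-1"] inj_onI)
    fix t assume "t \<in> {1/2..1} - insert (1/2) ((\<lambda>x. 2*x-1) -` S2)"
    then have "1/2 < t" "t \<le> 1" "2*t-1 \<notin> S2" by auto
    then show "?f t = 2 * (l (g2 (2*t-1)) * norm (vector_derivative g2 (at (2*t-1))))"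
      using d2[of t] by (simp, simp add: joinpaths_def)
  qed
  ultimately show ?thesis
    by (rule has_integral_combine[rotated 2]) auto
qed

text \<open>The displacement is the integral of the velocity, whose norm is at most the weighted
  speed because the weight is at least 1.\<close>

lemma weighted_length_ge_dist:
  fixes g :: "real \<Rightarrow> 'a::euclidean_space"
  assumes g: "valid_path g" and l: "\<And>z. 1 \<le> l z"
    and L: "((\<lambda>t. l (g t) * norm (vector_derivative g (at t))) has_integral L) {0..1}"
  shows "dist (pathstart g) (pathfinish g) \<le> L"
proof -
  obtain S where S: "finite S"
    "\<And>t. t \<in> {0..1} - S \<Longrightarrow> (g has_vector_derivative vector_derivative g (at t)) (at t)"
    using valid_path_vector_derivative[OF g] by metis
  have "((\<lambda>t. vector_derivative g (at t)) has_integral g 1 - g 0) {0..1}"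
    using S valid_path_imp_path[OF g]
    by (intro fundamental_theorem_of_calculus_strong[of S]) (auto simp: path_def)
  moreover have "norm (vector_derivative g (at t)) \<le> l (g t) * norm (vector_derivative g (at t))" for t
    using mult_right_mono[OF l, of "norm (vector_derivative g (at t))" "g t"] by simp
  ultimately have "norm (g 1 - g 0) \<le> L"
    using L integral_norm_bound_integral by (metis (no_types, lifting) has_integral_integrable_integral)
  then show ?thesis
    by (simp add: pathstart_def pathfinish_def dist_norm norm_minus_commute)
qed

lemma weighted_length_linepath:
  fixes p q :: "'a::euclidean_space"
  assumes l: "continuous_on UNIV l" and C: "\<And>z. z \<in> closed_segment p q \<Longrightarrow> l z \<le> C"
  obtains L where "L \<le> C * dist p q"
    "((\<lambda>t. l (linepath p q t) * norm (vector_derivative (linepath p q) (at t))) has_integral L) {0..1}"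
proof -
  let ?h = "\<lambda>t. l (linepath p q t) * norm (q - p)"
  have eq: "vector_derivative (linepath p q) (at t) = q - p" for t
    by (rule vector_derivative_at) (rule has_vector_derivative_linepath_within)
  have "continuous_on {0..1} ?h"
    by (intro continuous_intros continuous_on_compose2[OF l]) auto
  then have int: "?h integrable_on {0..1}"
    by (rule integrable_continuous_real)
  have "l (linepath p q t) \<le> C" if "t \<in> {0..1}" for t
    using C that linepath_image_01 by blast
  then have "integral {0..1} ?h \<le> integral {0..1::real} (\<lambda>t. C * norm (q - p))"
    by (intro integral_le int) (auto intro!: mult_right_mono)
  then have "integral {0..1} ?h \<le> C * dist p q"
    by (simp add: dist_norm norm_minus_commute)
  then show ?thesis
    using that[of "integral {0..1} ?h"] int by (simp add: eq has_integral_integral)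
qed

section \<open>The distance induced by a conformal immersion of the plane\<close>

locale conformal_plane =
  fixes X :: "complex \<Rightarrow> real^3" and D :: "complex \<Rightarrow> complex \<Rightarrow> real^3" and l :: "complex \<Rightarrow> real"
  assumes deriv: "\<And>z. (X has_derivative D z) (at z)"
    and conf: "\<And>z v. norm (D z v) = l z * norm v"
    and cont: "continuous_on UNIV l"
    and ge1: "\<And>z. 1 \<le> l z"
begin

abbreviation "\<Delta> \<equiv> induced_dist euclidean {(UNIV, id)} X"

text \<open>With the single chart \<open>id\<close> the admissible paths are the valid paths. Off
  finitely many parameters the chain rule and \<open>conf\<close> turn the speed of
  \<open>X \<circ> g\<close> into the weighted speed of \<open>g\<close>, and finitely many points
  do not affect the integral.\<close>

lemma induced_lengths_eq:
  "induced_lengths euclidean {(UNIV, id)} X p q =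
     {L. \<exists>g. valid_path g \<and> pathstart g = p \<and> pathfinish g = q \<and>
        ((\<lambda>t. l (g t) * norm (vector_derivative g (at t))) has_integral L) {0..1}}"
proof -
  have path: "piecewise_C1_path euclidean {(UNIV, id)} g \<longleftrightarrow> valid_path g" for g :: "real \<Rightarrow> complex"
    using valid_path_imp_path[of g]
    by (auto simp: piecewise_C1_path_def valid_path_def path_def pathin_def
        intro: piecewise_C1_differentiable_on_subset)
  have "((\<lambda>t. norm (vector_derivative (X \<circ> g) (at t))) has_integral L) {0..1} \<longleftrightarrow>
        ((\<lambda>t. l (g t) * norm (vector_derivative g (at t))) has_integral L) {0..1}"
    if g: "valid_path g" for g L
  proof -
    obtain S where S: "finite S"
      "\<And>t. t \<in> {0..1} - S \<Longrightarrow> (g has_vector_derivative vector_derivative g (at t)) (at t)"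
      using valid_path_vector_derivative[OF g] by metis
    have "vector_derivative (X \<circ> g) (at t) = D (g t) (vector_derivative g (at t))"
      if "t \<in> {0..1} - S" for t
      using S(2)[OF that] deriv
      by (intro vector_derivative_at vector_derivative_diff_chain_within)
         (auto intro: has_derivative_at_withinI)
    then show ?thesis
      by (intro has_integral_spike_finite_eq[OF S(1)]) (simp add: conf)
  qed
  then show ?thesis
    by (auto simp: induced_lengths_def path pathstart_def pathfinish_def)
qed

lemma dist_le_induced_lengths:
  assumes "L \<in> induced_lengths euclidean {(UNIV, id)} X p q"
  shows "dist p q \<le> L"
  using assms weighted_length_ge_dist[OF _ ge1] by (auto simp: induced_lengths_eq)

lemma bdd_below_induced_lengths: "bdd_below (induced_lengths euclidean {(UNIV, id)} X p q)"
  using dist_le_induced_lengths by (metis bdd_below.I)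

text \<open>Segments serve as competitors: they bound the induced distance from above and show that
  the infimum is over a nonempty set.\<close>

lemma induced_lengths_segment:
  assumes "\<And>z. z \<in> closed_segment p q \<Longrightarrow> l z \<le> C"
  obtains L where "L \<in> induced_lengths euclidean {(UNIV, id)} X p q" "L \<le> C * dist p q"
proof -
  from weighted_length_linepath[OF cont assms] obtain L where L: "L \<le> C * dist p q"
    "((\<lambda>t. l (linepath p q t) * norm (vector_derivative (linepath p q) (at t))) has_integral L) {0..1}"
    by metis
  then have "L \<in> induced_lengths euclidean {(UNIV, id)} X p q"
    by (auto simp: induced_lengths_eq intro!: exI[of _ "linepath p q"])
  with L(1) that show ?thesis by blast
qed

lemma bounded_on_compact:
  assumes "compact S"
  obtains C where "\<And>z. z \<in> S \<Longrightarrow> l z \<le> C"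
proof -
  have "compact (l ` S)"
    using assms cont by (meson compact_continuous_image continuous_on_subset subset_UNIV)
  then have "bdd_above (l ` S)"
    by (intro bounded_imp_bdd_above compact_imp_bounded)
  then show ?thesis
    using that by (auto simp: bdd_above_def)
qed

lemma induced_lengths_nonempty: "induced_lengths euclidean {(UNIV, id)} X p q \<noteq> {}"
proof -
  obtain C where "\<And>z. z \<in> closed_segment p q \<Longrightarrow> l z \<le> C"
    using bounded_on_compact compact_segment by metis
  then show ?thesis
    by (metis induced_lengths_segment empty_iff)
qed

lemma induced_dist_eq: "\<Delta> p q = Inf (induced_lengths euclidean {(UNIV, id)} X p q)"
  by (simp add: induced_dist_def)

lemma dist_le_induced_dist: "dist p q \<le> \<Delta> p q"
  unfolding induced_dist_eq
  by (intro cInf_greatest induced_lengths_nonempty dist_le_induced_lengths)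

lemma induced_dist_le:
  assumes "\<And>z. z \<in> closed_segment p q \<Longrightarrow> l z \<le> C"
  shows "\<Delta> p q \<le> C * dist p q"
  unfolding induced_dist_eq
  by (metis assms induced_lengths_segment cInf_lower2 bdd_below_induced_lengths)

lemma induced_lengths_commute:
  "induced_lengths euclidean {(UNIV, id)} X p q = induced_lengths euclidean {(UNIV, id)} X q p"
proof -
  have "induced_lengths euclidean {(UNIV, id)} X p q \<subseteq> induced_lengths euclidean {(UNIV, id)} X q p" for p q
  proof
    fix L assume "L \<in> induced_lengths euclidean {(UNIV, id)} X p q"
    then obtain g where "valid_path g" "pathstart g = p" "pathfinish g = q"
        "((\<lambda>t. l (g t) * norm (vector_derivative g (at t))) has_integral L) {0..1}"
      by (auto simp: induced_lengths_eq)
    then show "L \<in> induced_lengths euclidean {(UNIV, id)} X q p"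
      by (auto simp: induced_lengths_eq intro!: exI[of _ "reversepath g"] weighted_length_reversepath)
  qed
  then show ?thesis by blast
qed

text \<open>Concatenation bounds the left side by every sum \<open>L1 + L2\<close>; the infimum is
  then taken over \<open>L1\<close> first and over \<open>L2\<close> afterwards.\<close>

lemma induced_dist_triangle: "\<Delta> p r \<le> \<Delta> p q + \<Delta> q r"
proof -
  have "\<Delta> p r \<le> L1 + L2"
    if L: "L1 \<in> induced_lengths euclidean {(UNIV, id)} X p q"
      "L2 \<in> induced_lengths euclidean {(UNIV, id)} X q r" for L1 L2
  proof -
    obtain g1 g2 where "valid_path g1" "pathstart g1 = p" "pathfinish g1 = q"
        "valid_path g2" "pathstart g2 = q" "pathfinish g2 = r"
        "((\<lambda>t. l (g1 t) * norm (vector_derivative g1 (at t))) has_integral L1) {0..1}"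
        "((\<lambda>t. l (g2 t) * norm (vector_derivative g2 (at t))) has_integral L2) {0..1}"
      using L by (auto simp: induced_lengths_eq)
    then have "L1 + L2 \<in> induced_lengths euclidean {(UNIV, id)} X p r"
      by (auto simp: induced_lengths_eq intro!: exI[of _ "g1 +++ g2"] valid_path_join weighted_length_join)
    then show ?thesis
      unfolding induced_dist_eq by (intro cInf_lower bdd_below_induced_lengths)
  qed
  then have "\<Delta> p r - L2 \<le> \<Delta> p q" if "L2 \<in> induced_lengths euclidean {(UNIV, id)} X q r" for L2
    using that unfolding induced_dist_eq[of p q]
    by (intro cInf_greatest induced_lengths_nonempty) (fastforce simp: algebra_simps)
  then have "\<Delta> p r - \<Delta> p q \<le> \<Delta> q r"
    unfolding induced_dist_eq[of q r]
    by (intro cInf_greatest induced_lengths_nonempty) (fastforce simp: algebra_simps)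
  then show ?thesis by simp
qed

lemma Metric_space_induced_dist: "Metric_space UNIV \<Delta>"
proof
  fix p q r
  show "0 \<le> \<Delta> p q"
    using dist_le_induced_dist[of p q] zero_le_dist order_trans by blast
  show "\<Delta> p q = \<Delta> q p"
    unfolding induced_dist_eq by (subst induced_lengths_commute) simp
  show "\<Delta> p q = 0 \<longleftrightarrow> p = q"
  proof
    show "p = q" if "\<Delta> p q = 0"
      using dist_le_induced_dist[of p q] that by simp
    \<comment> \<open>The degenerate segment from \<open>p\<close> to \<open>p\<close> has length
      0.\<close>
    show "\<Delta> p q = 0" if "p = q"
      using induced_dist_le[of p p "l p"] dist_le_induced_dist[of p p] that by simp
  qed
  show "\<Delta> p r \<le> \<Delta> p q + \<Delta> q r"
    by (rule induced_dist_triangle)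
qed

text \<open>A Cauchy sequence for \<open>\<Delta>\<close> is Cauchy for the smaller Euclidean
  distance, hence has a Euclidean limit. Near this limit \<open>l\<close> is bounded, so
  \<open>\<Delta>\<close> is at most a multiple of the Euclidean distance and the convergence also
  holds for \<open>\<Delta>\<close>.\<close>

lemma complete_immersion_plane: "complete_immersion euclidean {(UNIV, id)} X"
proof -
  interpret M: Metric_space UNIV \<Delta> by (rule Metric_space_induced_dist)
  have "\<exists>p. limitin M.mtopology \<sigma> p sequentially" if \<sigma>: "M.MCauchy \<sigma>" for \<sigma>
  proof -
    have "\<exists>N. \<forall>m\<ge>N. \<forall>n\<ge>N. dist (\<sigma> m) (\<sigma> n) < e" if "e > 0" for e
      using \<sigma> that dist_le_induced_dist unfolding M.MCauchy_def by (meson le_less_trans)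
    then have "Cauchy \<sigma>"
      by (rule metric_CauchyI)
    then obtain p where p: "\<sigma> \<longlonglongrightarrow> p"
      using Cauchy_convergent convergent_def by blast
    obtain C where C: "\<And>z. z \<in> cball p 1 \<Longrightarrow> l z \<le> C"
      using bounded_on_compact compact_cball by metis
    have "\<Delta> (\<sigma> n) p \<le> C * dist (\<sigma> n) p" if "dist (\<sigma> n) p < 1" for n
    proof (rule induced_dist_le)
      fix z assume "z \<in> closed_segment (\<sigma> n) p"
      moreover have "closed_segment (\<sigma> n) p \<subseteq> cball p 1"
        using that by (intro closed_segment_subset) (auto simp: dist_commute)
      ultimately show "l z \<le> C" using C by blast
    qed
    moreover have "\<forall>\<^sub>F n in sequentially. dist (\<sigma> n) p < 1"
      using p by (rule tendstoD) simp
    ultimately have ev: "\<forall>\<^sub>F n in sequentially. \<Delta> (\<sigma> n) p \<le> C * dist (\<sigma> n) p"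
      by (metis (mono_tags, lifting) eventually_mono)
    have "(\<lambda>n. C * dist (\<sigma> n) p) \<longlonglongrightarrow> 0"
      using tendsto_mult_left[OF tendsto_dist[OF p tendsto_const[of p]], of C] by simp
    then have "(\<lambda>n. \<Delta> (\<sigma> n) p) \<longlonglongrightarrow> 0"
      by (rule tendsto_sandwich[OF _ ev tendsto_const, rotated]) simp
    then have "limitin M.mtopology \<sigma> p sequentially"
      by (simp add: M.limitin_metric_dist_null)
    then show ?thesis ..
  qed
  then show ?thesis
    by (simp add: complete_immersion_def M.Metric_space_axioms M.mcomplete_def)
qed

end

section \<open>The Weierstrass representation over the plane\<close>

lemma partial_deriv_Re:
  assumes "(F has_field_derivative F') (at z)"
  shows "partial_deriv v (\<lambda>z. Re (F z)) z = Re (F' * v)"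
proof -
  have "((\<lambda>z. Re (F z)) has_derivative (\<lambda>v. Re (F' * v))) (at z)"
    using assms unfolding has_field_derivative_def by (rule has_derivative_Re)
  then show ?thesis
    by (simp add: partial_deriv_def frechet_derivative_at[symmetric])
qed

text \<open>The second partial derivatives along \<open>v\<close> and \<open>w\<close> are
  \<open>Re (v * F2 z * w)\<close>; the choices \<open>v = w = 1\<close> and
  \<open>v = w = \<i>\<close> give opposite values.\<close>

lemma harmonic_on_Re_entire:
  assumes F: "F holomorphic_on UNIV"
  shows "harmonic_on (\<lambda>z. Re (F z)) UNIV"
proof -
  define F1 where "F1 = deriv F"
  define F2 where "F2 = deriv F1"
  have hol: "F1 holomorphic_on UNIV" "F2 holomorphic_on UNIV"
    unfolding F1_def F2_def using F by (auto intro!: holomorphic_deriv)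
  have d: "(F has_field_derivative F1 z) (at z)" "(F1 has_field_derivative F2 z) (at z)" for z
    unfolding F2_def using F hol(1) by (auto simp: F1_def intro!: holomorphic_derivI)
  have p1: "partial_deriv v (\<lambda>z. Re (F z)) = (\<lambda>z. Re (v * F1 z))" for v
    using partial_deriv_Re[OF d(1)] by (auto simp: mult.commute)
  have p2: "partial_deriv w (\<lambda>z. Re (v * F1 z)) = (\<lambda>z. Re (v * F2 z * w))" for v w
    using partial_deriv_Re[OF DERIV_cmult[OF d(2)]] by auto
  have diff: "(\<lambda>z. Re (G z)) differentiable_on UNIV" if "G holomorphic_on UNIV" for G
  proof -
    have "(\<lambda>z. Re (G z)) differentiable (at z)" for z
      using holomorphic_derivI[OF that open_UNIV UNIV_I, of z]
      unfolding has_field_derivative_def differentiable_def by (blast intro: has_derivative_Re)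
    then show ?thesis
      by (simp add: differentiable_on_def)
  qed
  have "C2_on (\<lambda>z. Re (F z)) UNIV"
    unfolding C2_on_def p1 p2 using holomorphic_on_imp_continuous_on[OF hol(2)]
    by (intro conjI ballI diff F continuous_intros holomorphic_intros hol)
  then show ?thesis
    unfolding harmonic_on_def p1 p2 by simp
qed

text \<open>The data with Gauss map \<open>g\<close> and height differential \<open>dz\<close>, normalised so that the third
  coordinate is \<open>Re z\<close>; the metric is then at least the Euclidean metric of the plane.\<close>

locale weierstrass_data =
  fixes g K H :: "complex \<Rightarrow> complex"
  assumes nz: "\<And>z. g z \<noteq> 0"
    and K_deriv: "\<And>z. (K has_field_derivative g z) (at z)"
    and H_deriv: "\<And>z. (H has_field_derivative inverse (g z)) (at z)"
begin

text \<open>The real part of the integrated Weierstrass forms. Here \<open>K\<close> and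
  \<open>H\<close> are primitives of \<open>g\<close> and \<open>1 / g\<close>, so the surface is
  fixed up to a translation.\<close>

definition X :: "complex \<Rightarrow> real^3" where
  "X z = vector [Re ((H z - K z) / 2), Re (\<i> * (H z + K z) / 2), Re z]"

definition D :: "complex \<Rightarrow> complex \<Rightarrow> real^3" where
  "D z v = vector [Re ((inverse (g z) - g z) / 2 * v), Re (\<i> * (inverse (g z) + g z) / 2 * v), Re v]"

definition \<rho> :: "complex \<Rightarrow> real" where
  "\<rho> z = ((norm (g z) + inverse (norm (g z))) / 2)\<^sup>2"

lemma holomorphic: "K holomorphic_on UNIV" "H holomorphic_on UNIV"
  using K_deriv H_deriv by (auto simp: holomorphic_on_open)

lemma X_has_derivative: "(X has_derivative D z) (at z)"
proof -
  have "((\<lambda>z. X z \<bullet> b) has_derivative (\<lambda>v. D z v \<bullet> b)) (at z)" if b: "b \<in> Basis" for b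
  proof -
    have "((\<lambda>z. X z $ i) has_derivative (\<lambda>v. D z v $ i)) (at z)" for i
    proof -
      have "((\<lambda>z. (H z - K z) / 2) has_field_derivative (inverse (g z) - g z) / 2) (at z)"
        by (auto intro!: derivative_eq_intros K_deriv H_deriv)
      moreover have "((\<lambda>z. \<i> * (H z + K z) / 2) has_field_derivative
          \<i> * (inverse (g z) + g z) / 2) (at z)"
        by (auto intro!: derivative_eq_intros K_deriv H_deriv)
      moreover have "((\<lambda>z. z) has_field_derivative 1) (at z)"
        by (rule DERIV_ident)
      ultimately have "\<forall>i. ((\<lambda>z. X z $ i) has_derivative (\<lambda>v. D z v $ i)) (at z)"
        unfolding forall_3 X_def D_def vector_3 has_field_derivative_def
        by (auto dest!: has_derivative_Re)
      then show ?thesis ..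
    qed
    moreover obtain i where "b = axis i 1"
      using b by (auto simp: Basis_vec_def)
    ultimately show ?thesis
      by (simp add: inner_axis)
  qed
  then show ?thesis
    by (subst has_derivative_componentwise_within) auto
qed

lemma frechet_derivative_X: "frechet_derivative X (at z) = D z"
  using X_has_derivative by (simp add: frechet_derivative_at[symmetric])

text \<open>Conformality rests on the squares of the three coefficients in \<open>D\<close> summing
  to 0: with \<open>a = g z\<close> and \<open>b = 1 / a\<close> the sum is
  \<open>1 - a * b\<close>. The real and imaginary parts of \<open>a * b = 1\<close> are the
  polynomial relations that the computation needs.\<close>

lemma inner_D: "D z v \<bullet> D z w = \<rho> z * (v \<bullet> w)"
proof -
  define a where "a = g z"
  define b where "b = inverse a"
  have ab: "a * b = 1"
    using nz[of z] by (simp add: a_def b_def)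
  have Re_ab: "Re a * Re b - Im a * Im b = 1" and Im_ab: "Re a * Im b + Im a * Re b = 0"
    using arg_cong[OF ab, of Re] arg_cong[OF ab, of Im] by simp_all
  have "norm a * norm b = 1"
    using ab by (metis norm_mult norm_one)
  then have "4 * \<rho> z = (norm a)\<^sup>2 + (norm b)\<^sup>2 + 2"
    unfolding \<rho>_def a_def[symmetric] norm_inverse[symmetric] b_def[symmetric]
    by (simp add: power2_sum power_divide)
  then have \<rho>: "4 * \<rho> z = (Re a)\<^sup>2 + (Im a)\<^sup>2 + (Re b)\<^sup>2 + (Im b)\<^sup>2 + 2"
    by (simp add: cmod_power2)
  have "4 * (D z v \<bullet> D z w) = 4 * \<rho> z * (v \<bullet> w)"
    unfolding \<rho> using Re_ab Im_ab
    unfolding inner_vec_def sum_3 D_def a_def[symmetric] b_def[symmetric] vector_3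
    by (simp add: inner_complex_def) algebra
  then show ?thesis by simp
qed

lemma \<rho>_ge_1: "1 \<le> \<rho> z"
proof -
  have "0 < norm (g z)" using nz by simp
  \<comment> \<open>The arithmetic-geometric inequality for \<open>norm (g z)\<close> and its
    inverse, from the square of \<open>norm (g z) - 1\<close>.\<close>
  then have "1 \<le> (norm (g z) + inverse (norm (g z))) / 2"
    using sum_squares_ge_zero[of "norm (g z) - 1" 0] by (simp add: field_simps)
  then show ?thesis
    unfolding \<rho>_def using one_le_power by blast
qed

lemma continuous_\<rho>: "continuous_on UNIV \<rho>"
proof -
  \<comment> \<open>Continuity of \<open>g\<close> comes from its being the derivative of an entire
    function.\<close>
  have "g = deriv K"
    using K_deriv by (intro ext) (metis DERIV_imp_deriv)
  then have "continuous_on UNIV g"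
    using holomorphic(1) by (simp add: holomorphic_deriv holomorphic_on_imp_continuous_on)
  then show ?thesis
    unfolding \<rho>_def[abs_def] using nz by (intro continuous_intros) auto
qed

text \<open>Inner products scale by \<open>\<rho>\<close>, so lengths scale by its square root,
  which is still at least 1. Completeness of \<open>X\<close> is inherited from here.\<close>

sublocale conformal_plane X D "\<lambda>z. sqrt (\<rho> z)"
proof
  show "norm (D z v) = sqrt (\<rho> z) * norm v" for z v
    by (simp add: norm_eq_sqrt_inner[of "D z v"] inner_D real_sqrt_mult norm_eq_sqrt_inner[of v])
qed (use X_has_derivative \<rho>_ge_1 in \<open>auto intro!: continuous_intros continuous_\<rho>\<close>)

lemma conformal_minimal_immersion_X: "conformal_minimal_immersion {(UNIV, id)} X"
proof -
  have chart: "in_chart X (UNIV, id) = X"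
    by (auto simp: in_chart_def)
  have "\<forall>i. harmonic_on (\<lambda>z. X z $ i) UNIV"
    unfolding forall_3 X_def vector_3
    by (intro conjI harmonic_on_Re_entire holomorphic_intros holomorphic) auto
  moreover have "inj (D z)" for z
  proof -
    interpret bounded_linear "D z"
      using X_has_derivative has_derivative_bounded_linear by blast
    have "v = 0" if "D z v = 0" for v
      using that conf[of z v] \<rho>_ge_1[of z] by auto
    then show ?thesis
      by (simp add: linear_axioms linear_inj_iff_eq_0)
  qed
  moreover have "\<exists>r>0. \<forall>v w. D z v \<bullet> D z w = r * (v \<bullet> w)" for z
    using inner_D[of z] \<rho>_ge_1[of z] by (auto intro!: exI[of _ "\<rho> z"])
  ultimately show ?thesis
    by (simp add: conformal_minimal_immersion_def chart frechet_derivative_X)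
qed

text \<open>The first fundamental form is \<open>\<rho> z\<close> times the identity, so its
  determinant is the square of \<open>\<rho> z\<close>.\<close>

lemma area_density_X: "area_density X z = \<rho> z"
  using \<rho>_ge_1[of z]
  by (simp add: area_density_def partial_deriv_def frechet_derivative_X inner_D inner_complex_def
      power2_eq_square[symmetric])

lemma area_element_X: "area_element euclidean {(UNIV, id)} X (density lborel (\<lambda>z. ennreal (\<rho> z)))"
proof -
  have chart: "in_chart X (UNIV, id) = X"
    by (auto simp: in_chart_def)
  have [measurable]: "\<rho> \<in> borel_measurable borel"
    by (rule borel_measurable_continuous_onI[OF continuous_\<rho>])
  have "sigma_sets UNIV (Collect open) = sets (borel :: complex measure)"
    by (simp add: borel_def)
  moreover have "emeasure (density lborel (\<lambda>z. ennreal (\<rho> z))) E = (\<integral>\<^sup>+ z\<in>E. ennreal (\<rho> z) \<partial>lborel)"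
    if "E \<in> sets borel" for E
    using that by (intro emeasure_density) auto
  ultimately show ?thesis
    by (auto simp: area_element_def chart area_density_X)
qed

end

section \<open>Logarithmic growth in vertical strips\<close>

text \<open>Integration along a vertical half line, starting at height 1 or -1. There
  \<open>c / z\<close> contributes \<open>c * ln \<bar>Im z\<bar>\<close> up to a bounded error, in
  both directions alike, and the rest of the derivative is integrable.\<close>

lemma bounded_strip_of_derivative:
  fixes F F' :: "complex \<Rightarrow> complex" and c :: complex
  assumes F: "\<And>z. \<bar>Re z\<bar> \<le> M \<Longrightarrow> 1 \<le> \<bar>Im z\<bar> \<Longrightarrow> (F has_field_derivative F' z) (at z)"
    and F': "\<And>z. \<bar>Re z\<bar> \<le> M \<Longrightarrow> 1 \<le> \<bar>Im z\<bar> \<Longrightarrow> norm (F' z - c / z) \<le> C / (Im z)\<^sup>2"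
  obtains B where "\<And>z. \<bar>Re z\<bar> \<le> M \<Longrightarrow> 1 \<le> \<bar>Im z\<bar> \<Longrightarrow> norm (F z - c * ln \<bar>Im z\<bar>) \<le> B"
proof -
  \<comment> \<open>The two compact segments on which all the vertical half lines start.\<close>
  define S where "S = (\<lambda>u. Complex u 1) ` {-M..M} \<union> (\<lambda>u. Complex u (-1)) ` {-M..M}"
  have cont: "continuous_on S F"
    unfolding S_def by (intro continuous_at_imp_continuous_on ballI DERIV_isCont[OF F]) auto
  have "compact S"
    unfolding S_def by (intro compact_Un compact_continuous_image continuous_on_Complex continuous_intros) auto
  then have "bounded (F ` S)"
    by (intro compact_imp_bounded compact_continuous_image cont)
  then obtain B where B: "\<And>z. z \<in> S \<Longrightarrow> norm (F z) \<le> B"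
    unfolding bounded_iff by auto
  \<comment> \<open>\<open>C\<close> is the error of the derivative against \<open>c / z\<close>;
    \<open>norm c * M\<close> is the cost of replacing \<open>c / z\<close> by its value on the
    imaginary axis.\<close>
  define E where "E = C + norm c * M"
  have "norm (F z - c * ln \<bar>Im z\<bar>) \<le> B + \<bar>E\<bar>" if z: "\<bar>Re z\<bar> \<le> M" "1 \<le> \<bar>Im z\<bar>" for z
  proof -
    define s where "s = sgn (Im z)"
    have s: "s = 1 \<or> s = -1"
      using z(2) by (auto simp: s_def sgn_if)
    define w where "w t = Complex (Re z) (s * t)" for t
    define f where "f t = F (w t) - c * of_real (ln t)" for t
    define f' where "f' t = \<i> * of_real s * F' (w t) - c * of_real (inverse t)" for t
    have w: "\<bar>Re (w t)\<bar> \<le> M" "1 \<le> \<bar>Im (w t)\<bar>" "\<bar>Im (w t)\<bar> = t" if "1 \<le> t" for t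
      using z s that by (auto simp: w_def)
    have w': "(w has_vector_derivative \<i> * of_real s) (at t)" for t
    proof -
      have "w = (\<lambda>t. of_real (Re z) + of_real t * (\<i> * of_real s))"
        by (auto simp: w_def fun_eq_iff complex_eq_iff)
      then show ?thesis
        by (auto intro!: derivative_eq_intros)
    qed
    have f: "(f has_vector_derivative f' t) (at t)" if t: "1 \<le> t" for t
    proof -
      have "((F \<circ> w) has_vector_derivative \<i> * of_real s * F' (w t)) (at t)"
        by (rule field_vector_diff_chain_at[OF w' F[OF w(1,2)[OF t]]])
      moreover have "((\<lambda>t. of_real (ln t) :: complex) has_vector_derivative of_real (inverse t)) (at t)"
        using t by (intro has_vector_derivative_of_real)
          (auto intro!: derivative_eq_intros simp: has_real_derivative_iff_has_vector_derivative[symmetric] divide_inverse)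
      ultimately show ?thesis
        unfolding f_def f'_def o_def
        by (intro has_vector_derivative_diff has_vector_derivative_mult_right)
    qed
    have f'_le: "norm (f' t) \<le> E / t\<^sup>2" if t: "1 \<le> t" for t
    proof -
      have nz: "w t \<noteq> 0"
        using w(2)[OF t] by auto
      \<comment> \<open>The numerator of the difference of the two fractions is only
        \<open>- Re z\<close>, bounded on the strip, which yields the decay
        \<open>M / (t * t)\<close>.\<close>
      have "\<i> * of_real s * of_real t - 1 * w t = - of_real (Re z)"
        by (auto simp: w_def complex_eq_iff)
      then have eq: "\<i> * of_real s / w t - of_real (inverse t) = - of_real (Re z) / (w t * of_real t)"
        using nz t diff_frac_eq[of "w t" "of_real t" "\<i> * of_real s" 1] by (simp add: inverse_eq_divide)
      have "t \<le> norm (w t)"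
        using w(3)[OF t] abs_Im_le_cmod[of "w t"] by simp
      then have "norm (\<i> * of_real s / w t - of_real (inverse t)) \<le> M / (t * t)"
        unfolding eq using t z(1) by (auto simp: norm_divide norm_mult intro!: frac_le mult_right_mono)
      then have 1: "norm (c * (\<i> * of_real s / w t - of_real (inverse t))) \<le> norm c * (M / (t * t))"
        unfolding norm_mult by (rule mult_left_mono) simp
      have "(Im (w t))\<^sup>2 = t\<^sup>2"
        using w(3)[OF t] by (metis power2_abs)
      then have 2: "norm (\<i> * of_real s * (F' (w t) - c / w t)) \<le> C / t\<^sup>2"
        using F'[OF w(1,2)[OF t]] s by (auto simp: norm_mult)
      have "f' t = \<i> * of_real s * (F' (w t) - c / w t) + c * (\<i> * of_real s / w t - of_real (inverse t))"
        by (simp add: f'_def algebra_simps)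
      also have "norm \<dots> \<le> C / t\<^sup>2 + norm c * (M / (t * t))"
        by (rule norm_triangle_mono[OF 2 1])
      also have "\<dots> = E / t\<^sup>2"
        by (simp add: E_def power2_eq_square add_divide_distrib)
      finally show ?thesis .
    qed
    define v where "v = \<bar>Im z\<bar>"
    have "norm (f v - f 1) \<le> \<bar>E\<bar>"
    proof (cases "1 < v")
      case True
      \<comment> \<open>\<open>- E / t\<close> is an antiderivative of the majorant
        \<open>E / t\<^sup>2\<close>.\<close>
      have "norm (f v - f 1) \<le> (- E / v) - (- E / 1)"
      proof (rule differentiable_bound_general[OF True, where f' = f'])
        show "continuous_on {1..v} f"
          using f by (intro continuous_at_imp_continuous_on ballI)
            (auto intro: has_vector_derivative_continuous)
        show "((\<lambda>t. - E / t) has_vector_derivative E / t\<^sup>2) (at t)" if "1 < t" for t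
          unfolding has_real_derivative_iff_has_vector_derivative[symmetric]
          using that by (auto intro!: derivative_eq_intros simp: power2_eq_square)
      qed (use f f'_le in \<open>auto intro!: continuous_intros\<close>)
      moreover have "0 \<le> E"
        using order_trans[OF norm_ge_zero f'_le[of 1]] by simp
      moreover from this have "0 \<le> E / v"
        using True by (intro divide_nonneg_pos) auto
      ultimately show ?thesis by simp
    next
      case False
      then have "v = 1" using z(2) by (simp add: v_def)
      then show ?thesis by simp
    qed
    moreover have "norm (f 1) \<le> B"
    proof -
      have "w 1 \<in> S"
        using s z(1) by (auto simp: S_def w_def abs_le_iff intro!: imageI)
      then show ?thesis
        using B by (simp add: f_def)
    qed
    moreover have "w v = z"
      by (simp add: w_def v_def s_def sgn_mult_abs complex_eq_iff)
    then have "f v = F z - c * ln \<bar>Im z\<bar>"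
      by (simp add: f_def v_def)
    ultimately show ?thesis
      using norm_triangle_mono[of "f v - f 1" "\<bar>E\<bar>" "f 1" B] by (simp add: add.commute)
  qed
  then show ?thesis by (rule that)
qed

text \<open>Chosen so that \<open>exp z * \<epsilon> z = (1 - exp (-z)) / z\<close> is entire with the nonoscillating part \<open>1 / z\<close>,
  whereas \<open>exp (-z) * \<epsilon> z\<close> only oscillates along vertical lines.\<close>

definition \<epsilon> :: "complex \<Rightarrow> complex" where
  "\<epsilon> z = (if z = 0 then 1 else (exp (-z) - exp (-2*z)) / z)"

text \<open>\<open>\<epsilon>\<close> is a difference quotient at 0 with a removable singularity;
  the value 1 is the derivative of the numerator there.\<close>

lemma holomorphic_\<epsilon>: "\<epsilon> holomorphic_on UNIV"
proof -
  let ?f = "\<lambda>z::complex. exp (-z) - exp (-2*z)"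
  have "(?f has_field_derivative 1) (at 0)"
    by (auto intro!: derivative_eq_intros)
  then have "deriv ?f 0 = 1"
    by (rule DERIV_imp_deriv)
  moreover have "(\<lambda>z. if z = 0 then deriv ?f 0 else (?f z - ?f 0) / (z - 0)) holomorphic_on UNIV"
    by (rule pole_lemma) (auto intro!: holomorphic_intros)
  ultimately have "(\<lambda>z. if z = 0 then 1 else (?f z - ?f 0) / (z - 0)) holomorphic_on UNIV"
    by (simp only:)
  also have "(\<lambda>z. if z = 0 then 1 else (?f z - ?f 0) / (z - 0)) = \<epsilon>"
    by (auto simp: \<epsilon>_def fun_eq_iff)
  finally show ?thesis .
qed

lemma norm_exp_le: "norm (exp (of_real a * z)) \<le> exp (\<bar>a\<bar> * \<bar>Re z\<bar>)"
  by (simp add: norm_exp_eq_Re) (metis abs_ge_self abs_mult)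

lemma norm_exp_remainder: "norm (exp w - 1 - w) \<le> exp (norm w) * (norm w)\<^sup>2" for w :: complex
  using Taylor_exp_field[of w 1] by (simp add: power2_eq_square algebra_simps)

section \<open>Pointwise bounds on a vertical strip away from the real axis\<close>

context
  fixes M :: real and z :: complex
  assumes strip: "\<bar>Re z\<bar> \<le> M" "1 \<le> \<bar>Im z\<bar>"
begin

lemma strip_exp_le: "0 \<le> k \<Longrightarrow> \<bar>a\<bar> \<le> k \<Longrightarrow> norm (exp (of_real a * z)) \<le> exp (k * M)"
  using norm_exp_le[of a z] strip(1) mult_mono[of "\<bar>a\<bar>" k "\<bar>Re z\<bar>" M]
  by (smt (verit) exp_le_cancel_iff)

lemma strip_exp_frac_le:
  assumes "\<bar>a\<bar> \<le> k" "1 \<le> (m::real)"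
  shows "norm (exp (of_real a * z) / of_real m) \<le> exp (k * M)"
proof -
  have "norm (exp (of_real a * z)) / m \<le> exp (k * M) / 1"
    using strip_exp_le[of k a] assms by (intro frac_le) auto
  then show ?thesis
    using assms by (simp add: norm_divide)
qed

lemma strip_nz: "z \<noteq> 0" and strip_norm_ge: "\<bar>Im z\<bar> \<le> norm z"
  using strip(2) abs_Im_le_cmod[of z] by auto

lemma strip_frac2:
  assumes "norm a \<le> A"
  shows "norm (a / z\<^sup>2) \<le> A / (Im z)\<^sup>2"
proof -
  have "(Im z)\<^sup>2 \<le> (norm z)\<^sup>2"
    using strip_norm_ge by (metis abs_ge_zero power2_abs power_mono)
  moreover have "0 < (Im z)\<^sup>2" using strip(2) by auto
  moreover have "0 \<le> A" using assms norm_ge_zero order_trans by blast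
  ultimately show ?thesis
    using assms by (auto simp: norm_divide norm_power intro!: frac_le)
qed

lemma strip_frac1:
  assumes "norm a \<le> A"
  shows "norm (a / z) \<le> A / \<bar>Im z\<bar>"
  using assms strip(2) strip_norm_ge order_trans[OF norm_ge_zero assms]
  by (auto simp: norm_divide intro!: frac_le)

lemma strip_frac:
  assumes "norm a \<le> A"
  shows "norm (a / z) \<le> A"
proof -
  have "A / \<bar>Im z\<bar> \<le> A / 1"
    using strip(2) order_trans[OF norm_ge_zero assms] by (intro divide_left_mono) auto
  then show ?thesis
    using strip_frac1[OF assms] by simp
qed

lemma strip_\<epsilon>_le: "norm (\<epsilon> z) \<le> 2 * exp (2 * M) / \<bar>Im z\<bar>"
proof -
  have "norm (exp (-z) - exp (-2*z)) \<le> exp (2 * M) + exp (2 * M)"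
    using strip_exp_le[of 2 "-1"] strip_exp_le[of 2 "-2"]
    by (intro order_trans[OF norm_triangle_ineq4] add_mono) auto
  then show ?thesis
    using strip_frac1[of "exp (-z) - exp (-2*z)"] strip_nz by (simp add: \<epsilon>_def)
qed

text \<open>Only the norm of \<open>w\<close> is prescribed so that the bound serves both
  \<open>\<epsilon> z\<close>, for the integral of \<open>g\<close>, and
  \<open>- \<epsilon> z\<close>, for that of \<open>1 / g\<close>.\<close>

lemma strip_remainder_le:
  fixes w :: complex
  assumes w: "norm w = norm (\<epsilon> z)"
  shows "norm (exp w - 1 - w) \<le> exp (2 * exp (2 * M)) * (2 * exp (2 * M))\<^sup>2 / (Im z)\<^sup>2"
proof -
  let ?L = "2 * exp (2 * M)"
  have "?L / \<bar>Im z\<bar> \<le> ?L / 1"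
    using strip(2) by (intro divide_left_mono) auto
  then have "norm w \<le> ?L"
    using strip_\<epsilon>_le w by simp
  moreover have "(norm w)\<^sup>2 \<le> (?L / \<bar>Im z\<bar>)\<^sup>2"
    using strip_\<epsilon>_le w by (intro power_mono) auto
  ultimately have "exp (norm w) * (norm w)\<^sup>2 \<le> exp ?L * (?L / \<bar>Im z\<bar>)\<^sup>2"
    by (intro mult_mono) auto
  then show ?thesis
    using norm_exp_remainder[of w] by (simp add: power_divide)
qed

end

section \<open>Asymptotics of the two primitives on a strip\<close>

lemma K_asymptotics:
  assumes K: "\<And>z. (K has_field_derivative exp (z + \<epsilon> z)) (at z)"
  obtains B where "\<And>z. \<bar>Re z\<bar> \<le> M \<Longrightarrow> 1 \<le> \<bar>Im z\<bar> \<Longrightarrow> norm (K z - ln \<bar>Im z\<bar>) \<le> B"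
proof -
  \<comment> \<open>The oscillating terms of the integrand are removed: \<open>exp z\<close> is
    integrated exactly, and \<open>- exp (-z) / z\<close> by parts, which leaves an error with
    denominator \<open>z\<^sup>2\<close>. Both removed primitives are bounded on the strip.\<close>
  define F where "F z = K z - exp z - exp (-z) / z" for z
  define F' where "F' z = exp (z + \<epsilon> z) - exp z + exp (-z) / z + exp (-z) / z\<^sup>2" for z
  define C where "C = exp M * (exp (2 * exp (2 * M)) * (2 * exp (2 * M))\<^sup>2) + exp M"
  have d: "(F has_field_derivative F' z) (at z)" if "\<bar>Re z\<bar> \<le> M" "1 \<le> \<bar>Im z\<bar>" for z
  proof -
    have "z \<noteq> 0" using that by auto
    then show ?thesis
      unfolding F_def F'_def
      by (auto intro!: derivative_eq_intros K simp: field_simps power2_eq_square)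
  qed
  have e: "norm (F' z - 1 / z) \<le> C / (Im z)\<^sup>2" if z: "\<bar>Re z\<bar> \<le> M" "1 \<le> \<bar>Im z\<bar>" for z
  proof -
    have nz: "z \<noteq> 0" using z by auto
    have "exp z * exp (-z) = 1" "exp z * exp (-2*z) = exp (-z)"
      by (simp_all flip: exp_add)
    then have "exp z * \<epsilon> z = 1 / z - exp (-z) / z"
      using nz by (simp add: \<epsilon>_def diff_divide_distrib right_diff_distrib)
    \<comment> \<open>The part of \<open>exp (\<epsilon> z)\<close> linear in
      \<open>\<epsilon> z\<close> supplies exactly the term \<open>1 / z\<close> behind the
      logarithm.\<close>
    then have eq: "F' z - 1 / z = exp z * (exp (\<epsilon> z) - 1 - \<epsilon> z) + exp (-z) / z\<^sup>2"
      by (simp add: F'_def exp_add algebra_simps)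
    have "norm (exp z * (exp (\<epsilon> z) - 1 - \<epsilon> z))
        \<le> exp M * (exp (2 * exp (2 * M)) * (2 * exp (2 * M))\<^sup>2 / (Im z)\<^sup>2)"
      unfolding norm_mult using strip_exp_le[OF z, of 1 1]
      by (intro mult_mono strip_remainder_le z) auto
    moreover have "norm (exp (-z) / z\<^sup>2) \<le> exp M / (Im z)\<^sup>2"
      using strip_exp_le[OF z, of 1 "-1"] by (intro strip_frac2 z) auto
    ultimately show ?thesis
      unfolding eq C_def add_divide_distrib
      by (intro norm_triangle_mono) auto
  qed
  obtain B where B: "\<And>z. \<bar>Re z\<bar> \<le> M \<Longrightarrow> 1 \<le> \<bar>Im z\<bar> \<Longrightarrow> norm (F z - ln \<bar>Im z\<bar>) \<le> B"
    using bounded_strip_of_derivative[of M F F' 1 C, OF d e] unfolding mult_1 by blast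
  have "norm (K z - ln \<bar>Im z\<bar>) \<le> B + exp M + exp M" if z: "\<bar>Re z\<bar> \<le> M" "1 \<le> \<bar>Im z\<bar>" for z
  proof -
    have "norm (exp z) \<le> exp M"
      using strip_exp_le[OF z, of 1 1] by simp
    moreover have "norm (exp (-z) / z) \<le> exp M"
      using strip_frac[OF z strip_exp_le[OF z, of 1 "-1"]] by simp
    moreover have "K z - ln \<bar>Im z\<bar> = (F z - ln \<bar>Im z\<bar>) + exp z + exp (-z) / z"
      by (simp add: F_def)
    ultimately show ?thesis
      using B[OF z] by (metis norm_triangle_mono)
  qed
  then show ?thesis by (rule that)
qed

lemma H_asymptotics:
  assumes H: "\<And>z. (H has_field_derivative exp (- z - \<epsilon> z)) (at z)"
  obtains B where "\<And>z. \<bar>Re z\<bar> \<le> M \<Longrightarrow> 1 \<le> \<bar>Im z\<bar> \<Longrightarrow> norm (H z) \<le> B"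
proof -
  \<comment> \<open>The bounded primitive of the leading oscillating terms \<open>exp (-z)\<close>
    and \<open>- (exp (-2*z) - exp (-3*z)) / z\<close>, the latter after one integration by
    parts.\<close>
  define P where "P z = - exp (-z) + exp (-2*z) / (2*z) - exp (-3*z) / (3*z)" for z :: complex
  define F' where "F' z = exp (- z - \<epsilon> z) - exp (-z) + (exp (-2*z) - exp (-3*z)) / z
    + exp (-2*z) / 2 / z\<^sup>2 - exp (-3*z) / 3 / z\<^sup>2" for z
  define C where "C = exp (3 * M) * (exp (2 * exp (2 * M)) * (2 * exp (2 * M))\<^sup>2)
    + exp (3 * M) + exp (3 * M)"
  have d: "((\<lambda>z. H z - P z) has_field_derivative F' z) (at z)" if "\<bar>Re z\<bar> \<le> M" "1 \<le> \<bar>Im z\<bar>" for z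
  proof -
    have "z \<noteq> 0" using that by auto
    then show ?thesis
      unfolding P_def F'_def
      by (auto intro!: derivative_eq_intros H simp: field_simps power2_eq_square)
  qed
  \<comment> \<open>All terms of order \<open>1 / z\<close> oscillate, so the coefficient
    \<open>c\<close> is 0 and no logarithm appears.\<close>
  have e: "norm (F' z - 0 / z) \<le> C / (Im z)\<^sup>2" if z: "\<bar>Re z\<bar> \<le> M" "1 \<le> \<bar>Im z\<bar>" for z
  proof -
    have nz: "z \<noteq> 0" using z by auto
    have "exp (-z) * exp (-z) = exp (-2*z)" "exp (-z) * exp (-2*z) = exp (-3*z)"
      by (simp_all flip: exp_add)
    then have "exp (-z) * \<epsilon> z = (exp (-2*z) - exp (-3*z)) / z"
      using nz by (simp add: \<epsilon>_def right_diff_distrib)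
    moreover have "exp (- z - \<epsilon> z) = exp (-z) * exp (- \<epsilon> z)"
      by (simp flip: exp_add)
    ultimately have eq: "F' z - 0 / z = exp (-z) * (exp (- \<epsilon> z) - 1 - (- \<epsilon> z))
        + exp (-2*z) / 2 / z\<^sup>2 - exp (-3*z) / 3 / z\<^sup>2"
      by (simp add: F'_def algebra_simps)
    have "norm (exp (-z) * (exp (- \<epsilon> z) - 1 - (- \<epsilon> z)))
        \<le> exp (3 * M) * (exp (2 * exp (2 * M)) * (2 * exp (2 * M))\<^sup>2 / (Im z)\<^sup>2)"
      unfolding norm_mult using strip_exp_le[OF z, of 3 "-1"]
      by (intro mult_mono strip_remainder_le z) auto
    moreover have "norm (exp (of_real a * z) / of_real k / z\<^sup>2) \<le> exp (3 * M) / (Im z)\<^sup>2"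
      if "\<bar>a\<bar> \<le> 3" "1 \<le> k" for a k
      by (rule strip_frac2[OF z strip_exp_frac_le[OF z that]])
    from this[of "-2" 2] this[of "-3" 3]
    have "norm (exp (-2*z) / 2 / z\<^sup>2) \<le> exp (3 * M) / (Im z)\<^sup>2"
      "norm (exp (-3*z) / 3 / z\<^sup>2) \<le> exp (3 * M) / (Im z)\<^sup>2" by simp_all
    ultimately show ?thesis
      unfolding eq C_def add_divide_distrib
      by (intro order_trans[OF norm_triangle_ineq4] add_mono norm_triangle_mono) auto
  qed
  obtain B where B: "\<And>z. \<bar>Re z\<bar> \<le> M \<Longrightarrow> 1 \<le> \<bar>Im z\<bar> \<Longrightarrow> norm (H z - P z) \<le> B"
    using bounded_strip_of_derivative[of M "\<lambda>z. H z - P z" F' 0 C, OF d e]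
    unfolding mult_zero_left diff_0_right by blast
  have "norm (H z) \<le> B + (exp (3 * M) + exp (3 * M) + exp (3 * M))"
    if z: "\<bar>Re z\<bar> \<le> M" "1 \<le> \<bar>Im z\<bar>" for z
  proof -
    have frac: "norm (exp (of_real a * z) / (of_real k * z)) \<le> exp (3 * M)"
      if "\<bar>a\<bar> \<le> 3" "1 \<le> k" for a k
    proof -
      have "norm (exp (of_real a * z) / of_real k / z) \<le> exp (3 * M)"
        by (rule strip_frac[OF z strip_exp_frac_le[OF z that]])
      then show ?thesis by (simp add: divide_divide_eq_left)
    qed
    have "norm (P z) \<le> exp (3 * M) + exp (3 * M) + exp (3 * M)"
      unfolding P_def
      using strip_exp_le[OF z, of 3 "-1"] frac[of "-2" 2] frac[of "-3" 3]
      by (intro order_trans[OF norm_triangle_ineq4] add_mono norm_triangle_mono) auto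
    then show ?thesis
      using B[OF z] norm_triangle_mono[of "H z - P z" B "P z"] by simp
  qed
  then show ?thesis by (rule that)
qed

section \<open>The surface\<close>

lemma simply_connected_space_plane: "simply_connected_space (euclidean :: complex topology)"
  unfolding simply_connected_space_def
proof (intro allI impI)
  fix p q :: "real \<Rightarrow> complex"
  assume "pathin euclidean p \<and> p 1 = p 0 \<and> pathin euclidean q \<and> q 1 = q 0"
  then have "homotopic_loops UNIV p q"
    by (intro homotopic_loops_linear) (auto simp: pathin_def path_def pathstart_def pathfinish_def)
  then show "homotopic_with (\<lambda>r. r 1 = r 0) (top_of_set {0..1}) euclidean p q"
    by (simp add: homotopic_loops_def pathstart_def pathfinish_def)
qed

lemma riemann_surface_plane: "riemann_surface (euclidean :: complex topology) {(UNIV, id)}"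
proof -
  have "inv_into UNIV id = (id :: complex \<Rightarrow> complex)"
    by (simp add: fun_eq_iff)
  moreover have "homeomorphic_map euclidean euclidean (id :: complex \<Rightarrow> complex)"
    by (simp add: homeomorphic_map_id)
  moreover have "connected_space (euclidean :: complex topology)"
    by (metis connected_UNIV connectedin_iff_connected connectedin_topspace topspace_euclidean)
  moreover have "second_countable (euclidean :: complex topology)"
  proof -
    obtain \<B> :: "complex set set" where "countable \<B>" "\<And>S. S \<in> \<B> \<Longrightarrow> open S"
        "\<And>S. open S \<Longrightarrow> \<exists>U. U \<subseteq> \<B> \<and> S = \<Union>U"
      by (metis univ_second_countable)
    then show ?thesis
      unfolding second_countable_def open_openin[symmetric]
      by (intro exI[of _ \<B>] conjI ballI allI impI) (assumption, blast, metis UnionE Union_upper subset_eq)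
  qed
  ultimately show ?thesis
    by (auto simp: riemann_surface_def holomorphic_atlas_def complex_chart_def
        Hausdorff_space_euclidean)
qed

lemma entire_primitive:
  assumes "f holomorphic_on UNIV"
  obtains F where "\<And>z. (F has_field_derivative f z) (at z)"
  using holomorphic_convex_primitive'[OF convex_UNIV open_UNIV assms] that by auto

theorem theorem3p8:
  shows "\<exists>(\<Omega> :: complex topology) (A :: complex chart set) (X :: complex \<Rightarrow> real^3)
            (dA :: complex measure) (C :: real) (c :: real).
           riemann_surface \<Omega> A \<and> simply_connected_space \<Omega> \<and>
           conformal_minimal_immersion A X \<and> complete_immersion \<Omega> A X \<and>
           proper_immersion \<Omega> X \<and> area_element \<Omega> A X dA \<and> C > 0 \<and> c > 0 \<and>
           (\<forall>\<^sub>F R in at_top.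
              (\<integral>\<^sup>+ p\<in>{p \<in> topspace \<Omega>. X p \<in> ball 0 R}. 1 \<partial>dA) \<ge> ennreal (C * exp (c * R)))"
proof -
  have hol1: "(\<lambda>z. exp (z + \<epsilon> z)) holomorphic_on UNIV"
    and hol2: "(\<lambda>z. exp (- z - \<epsilon> z)) holomorphic_on UNIV"
    by (intro holomorphic_intros holomorphic_\<epsilon>)+
  obtain K where K: "\<And>z. (K has_field_derivative exp (z + \<epsilon> z)) (at z)"
    using entire_primitive[of "\<lambda>z. exp (z + \<epsilon> z)"]
    by (metis (no_types, lifting) hol1)
  obtain H where H: "\<And>z. (H has_field_derivative exp (- z - \<epsilon> z)) (at z)"
    using entire_primitive[of "\<lambda>z. exp (- z - \<epsilon> z)"]
    by (metis (no_types, lifting) hol2)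
  have inv: "inverse (exp (z + \<epsilon> z)) = exp (- z - \<epsilon> z)" for z
    by (simp flip: exp_minus)
  interpret weierstrass_data "\<lambda>z. exp (z + \<epsilon> z)" K H
    by unfold_locales (simp_all only: K H inv exp_not_eq_zero not_False_eq_True)
  \<comment> \<open>The logarithm is real. It therefore enters the first coordinate, with factor
    \<open>- 1 / 2\<close> from \<open>- K / 2\<close>, but not the second, which depends on the
    imaginary parts of \<open>H\<close> and \<open>K\<close>.\<close>
  have strip: "\<exists>B. \<forall>z. \<bar>Re z\<bar> \<le> M \<longrightarrow> 1 \<le> \<bar>Im z\<bar> \<longrightarrow>
      \<bar>X z $ 1 + ln \<bar>Im z\<bar> / 2\<bar> \<le> B \<and> \<bar>X z $ 2\<bar> \<le> B" for M
  proof -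
    obtain B1 where B1: "\<And>z. \<bar>Re z\<bar> \<le> M \<Longrightarrow> 1 \<le> \<bar>Im z\<bar> \<Longrightarrow> norm (K z - ln \<bar>Im z\<bar>) \<le> B1"
      using K_asymptotics[OF K] by metis
    obtain B2 where B2: "\<And>z. \<bar>Re z\<bar> \<le> M \<Longrightarrow> 1 \<le> \<bar>Im z\<bar> \<Longrightarrow> norm (H z) \<le> B2"
      using H_asymptotics[OF H] by metis
    have "\<bar>X z $ 1 + ln \<bar>Im z\<bar> / 2\<bar> \<le> B1 + B2 \<and> \<bar>X z $ 2\<bar> \<le> B1 + B2"
      if z: "\<bar>Re z\<bar> \<le> M" "1 \<le> \<bar>Im z\<bar>" for z
      using B1[OF z] B2[OF z] abs_Re_le_cmod[of "K z - ln \<bar>Im z\<bar>"] abs_Im_le_cmod[of "K z - ln \<bar>Im z\<bar>"]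
        abs_Re_le_cmod[of "H z"] abs_Im_le_cmod[of "H z"]
      by (simp add: X_def abs_if split: if_splits) (auto simp: field_simps)
    then show ?thesis by blast
  qed
  have X3: "X z $ 3 = Re z" for z
    by (simp add: X_def)
  have contX: "continuous_on UNIV X"
    using X_has_derivative by (auto intro!: continuous_at_imp_continuous_on has_derivative_continuous)
  have "proper_immersion euclidean X"
    unfolding proper_immersion_def
  proof (intro allI impI)
    fix S :: "(real^3) set" assume S: "compact S"
    then obtain R where R: "\<And>x. x \<in> S \<Longrightarrow> norm x \<le> R"
      by (meson compact_imp_bounded bounded_iff)
    obtain B where B: "\<And>z. \<bar>Re z\<bar> \<le> R \<Longrightarrow> 1 \<le> \<bar>Im z\<bar> \<Longrightarrow> \<bar>X z $ 1 + ln \<bar>Im z\<bar> / 2\<bar> \<le> B"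
      using strip by meson
    \<comment> \<open>The height bounds \<open>Re z\<close> by \<open>R\<close>. The first
      coordinate then forces \<open>ln \<bar>Im z\<bar> \<le> 2 * (R + B)\<close>, and the summand 1
      covers the points with \<open>\<bar>Im z\<bar> < 1\<close>.\<close>
    have "norm z \<le> R + (1 + exp (2 * (R + B)))" if z: "X z \<in> S" for z
    proof -
      have x: "\<bar>X z $ i\<bar> \<le> R" for i
        using component_le_norm_cart[of "X z" i] R[OF z] by simp
      then have Re: "\<bar>Re z\<bar> \<le> R"
        using X3 by metis
      have "\<bar>Im z\<bar> \<le> 1 + exp (2 * (R + B))"
      proof (cases "1 \<le> \<bar>Im z\<bar>")
        case True
        then have "ln \<bar>Im z\<bar> \<le> 2 * (R + B)"
          using abs_le_D1[OF B[OF Re True]] abs_le_D2[OF x[of 1]] by simp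
        then have "\<bar>Im z\<bar> \<le> exp (2 * (R + B))"
          using True by (metis exp_le_cancel_iff exp_ln less_le_trans zero_less_one)
        then show ?thesis by simp
      qed (use exp_ge_zero[of "2 * (R + B)"] in linarith)
      with Re show ?thesis
        using cmod_le[of z] by linarith
    qed
    then have "bounded {z. X z \<in> S}"
      unfolding bounded_iff by blast
    moreover have "closed {z. X z \<in> S}"
      using continuous_closed_vimage[of S X] contX compact_imp_closed[OF S]
      by (simp add: vimage_def continuous_on_eq_continuous_at)
    ultimately show "compactin euclidean {p \<in> topspace euclidean. X p \<in> S}"
      by (simp add: compact_eq_bounded_closed)
  qed
  \<comment> \<open>The witnesses are \<open>C = 1\<close> and \<open>c = 1\<close>.\<close>
  moreover have "\<forall>\<^sub>F R in at_top.
      (\<integral>\<^sup>+ p\<in>{p \<in> topspace euclidean. X p \<in> ball 0 R}. 1 \<partial>density lborel (\<lambda>z. ennreal (\<rho> z)))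
        \<ge> ennreal (1 * exp (1 * R))"
  proof -
    obtain B where B: "\<And>z. \<bar>Re z\<bar> \<le> 1 \<Longrightarrow> 1 \<le> \<bar>Im z\<bar> \<Longrightarrow>
        \<bar>X z $ 1 + ln \<bar>Im z\<bar> / 2\<bar> \<le> B \<and> \<bar>X z $ 2\<bar> \<le> B"
      using strip by meson
    have "ennreal (1 * exp (1 * R)) \<le>
        (\<integral>\<^sup>+ p\<in>{p \<in> topspace euclidean. X p \<in> ball 0 R}. 1 \<partial>density lborel (\<lambda>z. ennreal (\<rho> z)))"
      \<comment> \<open>On the rectangle the coordinates are at most \<open>R / 2 + B\<close>,
        \<open>B\<close> and 1 in absolute value; their sum is below \<open>R\<close> once
        \<open>2 * B + 2 \<le> R / 2\<close>.\<close>
      if R: "R \<ge> max 1 (4 * B + 4)" for R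
    proof -
      \<comment> \<open>At height up to \<open>exp R\<close> the logarithm is at most
        \<open>R\<close>, so the first coordinate uses up only half of the radius.\<close>
      define Q where "Q = cbox (Complex (-1) 1) (Complex 1 (exp R))"
      have R': "1 \<le> R" "2 * B + 2 \<le> R / 2" using R by auto
      have "2 \<le> exp R"
        using exp_ge_add_one_self[of R] R'(1) by linarith
      have Q: "Q \<subseteq> {z. X z \<in> ball 0 R}"
      proof safe
        fix z assume "z \<in> Q"
        then have z: "\<bar>Re z\<bar> \<le> 1" "1 \<le> Im z" "Im z \<le> exp R"
          by (auto simp: Q_def in_cbox_complex_iff)
        have "ln (Im z) \<le> R"
          using z by (metis exp_gt_zero ln_exp ln_le_cancel_iff less_le_trans zero_less_one)
        moreover have "0 \<le> ln (Im z)"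
          using z by simp
        moreover have "norm (X z) \<le> \<bar>X z $ 1\<bar> + \<bar>X z $ 2\<bar> + \<bar>X z $ 3\<bar>"
          using norm_le_l1_cart[of "X z"] by (simp add: sum_3)
        moreover have "\<bar>X z $ 1 + ln (Im z) / 2\<bar> \<le> B" "\<bar>X z $ 2\<bar> \<le> B"
          using B[of z] z by auto
        moreover have "\<bar>X z $ 3\<bar> \<le> 1"
          using z X3 by metis
        ultimately have "norm (X z) < R"
          using R' by linarith
        then show "X z \<in> ball 0 R" by simp
      qed
      have meas: "{z. X z \<in> ball 0 R} \<in> sets borel"
        using open_vimage[OF open_ball contX, of 0 R] by (simp add: vimage_def)
      have [measurable]: "\<rho> \<in> borel_measurable borel"
        by (rule borel_measurable_continuous_onI[OF continuous_\<rho>])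
      \<comment> \<open>The rectangle has width 2 and height \<open>exp R - 1\<close>.\<close>
      have "ennreal (exp R) \<le> ennreal (2 * (exp R - 1))"
        using \<open>2 \<le> exp R\<close> by (intro ennreal_leI) simp
      also have "\<dots> = emeasure lborel Q"
        using \<open>2 \<le> exp R\<close> R'(1) unfolding Q_def
        by (subst emeasure_lborel_cbox) (auto simp: Basis_complex_def ennreal_mult)
      also have "\<dots> = (\<integral>\<^sup>+ z\<in>Q. 1 \<partial>lborel)"
        by (simp add: Q_def)
      \<comment> \<open>Euclidean area is at most induced area because \<open>\<rho>\<close> is at
        least 1.\<close>
      also have "\<dots> \<le> (\<integral>\<^sup>+ z\<in>{z. X z \<in> ball 0 R}. ennreal (\<rho> z) \<partial>lborel)"
        using Q \<rho>_ge_1 by (intro nn_integral_mono) (auto simp: indicator_def)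
      also have "\<dots> = (\<integral>\<^sup>+ z\<in>{z. X z \<in> ball 0 R}. 1 \<partial>density lborel (\<lambda>z. ennreal (\<rho> z)))"
        using meas by (simp add: emeasure_density)
      finally show ?thesis by simp
    qed
    then show ?thesis
      unfolding eventually_at_top_linorder by blast
  qed
  ultimately show ?thesis
    using riemann_surface_plane simply_connected_space_plane conformal_minimal_immersion_X
      complete_immersion_plane area_element_X zero_less_one by blast
qed

end
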